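(* For any $A\in\bar{\mathcal P}([n])$, one has the decomposition $$L(\Gamma(A))=\bigoplus_{B\in\bar{\mathcal P}(A)}\phi_A(H_B).$$ In addition, for every $B\in\bar{\mathcal P}(A)$: 1. $\phi_A$ is injective on $H_B$, i.e. $\ker\phi_A\cap H_B=\{0\}$; 2. for all $F\in H_B$ and all $A'\in\bar{\mathcal P}(A)$, $M_{A'}\phi_AF=\phi_{A'}F$; 3. $\dim H_B=d_{|B|}$, where $d_k$ is the number of fixed-point free permutations (derangements) of a set with $k$ elements.
   Context: Let $n\ge 1$ and $[n]=\{1,\dots,n\}$. For a finite set $E$: $\mathcal P(E)=\{A\subset E: |A|\ge 2\}$, $\bar{\mathcal P}(E)=\mathcal P(E)\cup\{\emptyset\}$, $L(E)$ is the space of functions $E\to\mathbb R$, $\delta_x$ is the Dirac function at $x$, $\mathbf 1_S$ the indicator of $S$. An injective word on $[n]$ is a finite sequence $\pi=\pi_1\cdots\pi_k$ of distinct elements of $[n]$; its content is $c(\pi)=\{\pi_1,\dots,\pi_k\}$ and its length $|\pi|=k$. The empty word is $\bar 0$, with content $\emptyset$. $\Gamma(A)$ is the set of injective words with content $A$ (so $\Gamma(\emptyset)=\{\bar 0\}$), $\Gamma_n=\bigsqcup_{A\in\mathcal P([n])}\Gamma(A)$, $\bar\Gamma_n=\Gamma_n\cup\{\bar 0\}$. Each $L(\Gamma(A))$ is embedded in $L(\bar\Gamma_n)$ by extension by zero, so $L(\bar\Gamma_n)=\bigoplus_{A\in\bar{\mathcal P}([n])}L(\Gamma(A))$. $\pi\subset\sigma$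 means that $\pi$ is a (not necessarily contiguous) subword of $\sigma$; $\pi\sqsubset\sigma$ means that $\pi$ is a contiguous subword of $\sigma$. Marginal operators: for $A\in\mathcal P([n])$, $M_A:L(\bar\Gamma_n)\to L(\Gamma(A))$ is $M_AF(\pi)=\sum_{\sigma\in\Gamma_n,\,\pi\subset\sigma}F(\sigma)$; and $M_\emptyset F=\big(\sum_{\pi\in\bar\Gamma_n}F(\pi)\big)\delta_{\bar 0}$. By convention $M_A=M_\emptyset$ if $|A|=1$. Spaces: $H_\emptyset=L(\Gamma(\emptyset))=\mathbb R\delta_{\bar 0}$, and for $B\in\mathcal P([n])$, $H_B=\{F\in L(\Gamma(B)): M_{B'}F=0\text{ for all }B'\subsetneq B\}$. Synthesis operators: for $A\in\bar{\mathcal P}([n])$, $\phi_A:L(\bar\Gamma_n)\to L(\Gamma(A))$ is the linear map with $\phi_A\delta_{\bar 0}=\frac1{|A|!}\mathbf 1_{\Gamma(A)}$ and, for $\pi\ne\bar 0$, $\phi_A\delta_\pi=\frac1{(|A|-|\pi|+1)!}\mathbf 1_{\{\sigma\in\Gamma(A):\pi\sqsubset\sigma\}}$ if $c(\pi)\subset A$, and $\phi_A\delta_\pi=0$ otherwise. Convention: $d_0=1$ (and $d_1=0$). *)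

theory Defs
  imports
    "HOL-Analysis.Analysis"
    "HOL-Combinatorics.Combinatorics"
    "HOL-Library.Function_Algebras"
    "HOL-Library.Sublist"
begin

text \<open>Real-valued functions form a real vector space under pointwise operations.\<close>

instantiation "fun" :: (type, real_vector) real_vector
begin

definition scaleR_fun :: "real \<Rightarrow> ('a \<Rightarrow> 'b) \<Rightarrow> 'a \<Rightarrow> 'b"
  where "scaleR_fun c f = (\<lambda>x. c *\<^sub>R f x)"

instance
  by standard (auto simp: scaleR_fun_def fun_eq_iff scaleR_add_right scaleR_add_left)

end

text \<open>
  Functions on a set \<open>E\<close> are represented as functions on the whole type that vanish
  off \<open>E\<close>, so that extension by zero is the identity.
\<close>

definition L :: "'a set \<Rightarrow> ('a \<Rightarrow> real) set"
  where "L E = {F. \<forall>x. x \<notin> E \<longrightarrow> F x = 0}"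

abbreviation dirac :: "'a \<Rightarrow> 'a \<Rightarrow> real"
  where "dirac x \<equiv> indicator {x}"

definition Subsets2 :: "'a set \<Rightarrow> 'a set set"
  where "Subsets2 E = {A. A \<subseteq> E \<and> card A \<ge> 2}"

definition Subsets2_bar :: "'a set \<Rightarrow> 'a set set"
  where "Subsets2_bar E = Subsets2 E \<union> {{}}"

text \<open>
  An injective word is a distinct list, its content is \<open>set\<close>, and the empty word is \<open>[]\<close>.
\<close>

abbreviation words :: "nat set \<Rightarrow> nat list set"
  where "words A \<equiv> permutations_of_set A"

definition words_n :: "nat \<Rightarrow> nat list set"
  where "words_n n = (\<Union>A\<in>Subsets2 {1..n}. words A)"

definition words_bar :: "nat \<Rightarrow> nat list set"
  where "words_bar n = words_n n \<union> {[]}"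

text \<open>
  Marginal operators. The first case covers \<open>A = {}\<close> as well as the convention that the
  marginal on a singleton is the marginal on the empty set.
\<close>

definition marginal :: "nat \<Rightarrow> nat set \<Rightarrow> (nat list \<Rightarrow> real) \<Rightarrow> nat list \<Rightarrow> real"
  where "marginal n A F =
    (if card A \<le> 1 then (\<Sum>\<pi>\<in>words_bar n. F \<pi>) *\<^sub>R dirac []
     else (\<lambda>\<pi>. if \<pi> \<in> words A then (\<Sum>\<sigma> | \<sigma> \<in> words_n n \<and> subseq \<pi> \<sigma>. F \<sigma>) else 0))"

definition H :: "nat \<Rightarrow> nat set \<Rightarrow> (nat list \<Rightarrow> real) set"
  where "H n B =
    (if B = {} then L (words {})
     else {F \<in> L (words B). \<forall>B'. B' \<subset> B \<longrightarrow> marginal n B' F = 0})"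

text \<open>
  Synthesis operators: \<open>synth_dirac A \<pi>\<close> is the prescribed image of \<open>dirac \<pi>\<close>, and
  \<open>synth n A\<close> is its linear extension to \<open>L (words_bar n)\<close>. When \<open>set \<pi> \<subseteq> A\<close>, the natural
  number subtraction does not truncate.
\<close>

definition synth_dirac :: "nat set \<Rightarrow> nat list \<Rightarrow> nat list \<Rightarrow> real"
  where "synth_dirac A \<pi> =
    (if \<pi> = [] then (1 / fact (card A)) *\<^sub>R indicator (words A)
     else if set \<pi> \<subseteq> A then
       (1 / fact (card A - length \<pi> + 1)) *\<^sub>R indicator {\<sigma> \<in> words A. sublist \<pi> \<sigma>}
     else 0)"

definition synth :: "nat \<Rightarrow> nat set \<Rightarrow> (nat list \<Rightarrow> real) \<Rightarrow> nat list \<Rightarrow> real"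
  where "synth n A F = (\<Sum>\<pi>\<in>words_bar n. F \<pi> *\<^sub>R synth_dirac A \<pi>)"

definition is_direct_sum :: "'v::real_vector set \<Rightarrow> 'i set \<Rightarrow> ('i \<Rightarrow> 'v set) \<Rightarrow> bool"
  where "is_direct_sum V I W \<longleftrightarrow>
    subspace V \<and> finite I \<and> (\<forall>i\<in>I. subspace (W i) \<and> W i \<subseteq> V) \<and>
    (\<forall>v\<in>V. \<exists>!w. w \<in> (\<Pi>\<^sub>E i\<in>I. W i) \<and> v = (\<Sum>i\<in>I. w i))"

definition derangement_number :: "nat \<Rightarrow> nat"
  where "derangement_number k = card {p. p permutes {1..k} \<and> (\<forall>i\<in>{1..k}. p i \<noteq> i)}"

end

theory Submission
  imports Defs
begin

text \<open>
  Everything rests on one commutation rule: a function in \<open>H n B\<close>, synthesised on \<open>A\<close> and then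
  marginalised to \<open>A' \<subseteq> A\<close>, is the same function synthesised on \<open>A'\<close>
  (\<open>word_marginal_synth\<close>).  A marginal from \<open>A\<close> to \<open>A'\<close> is the pushforward along the map that
  erases the letters outside \<open>A'\<close>, so it suffices to erase one letter \<open>a\<close>.  If \<open>a\<close> lies outside
  \<open>B\<close>, each word on \<open>A - {a}\<close> with a contiguous block \<open>\<pi>\<close> on \<open>B\<close> arises from as many words as
  there are places for \<open>a\<close> that do not cut the block, and this number is exactly the ratio of the
  two factorials in the definition of the synthesis.  If \<open>a\<close> lies in \<open>B\<close>, a block \<open>\<pi>\<close> on \<open>B\<close> can
  be completed only where \<open>\<pi>\<close> without \<open>a\<close> already stands as a block, and there by exactly one
  insertion.  Hence only the marginal of the function on \<open>B - {a}\<close> enters, and that vanishes.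

  Two extreme cases turn this rule into a triangular system indexed by sets: synthesis on \<open>B\<close>
  itself is the identity on \<open>H n B\<close>, and synthesis on a set that does not contain \<open>B\<close> is zero.
  Marginalising to \<open>B\<close> therefore inverts the synthesis on \<open>H n B\<close>.  Marginalising a vanishing sum of
  synthesised components to one index set after another, in the order of inclusion, shows that
  all components vanish (\<open>sum_synth_eq_0\<close>).  Conversely the system can be solved: the component
  of \<open>F\<close> at \<open>B\<close> is its marginal on \<open>B\<close> minus what the components at the proper subsets of \<open>B\<close>
  contribute there (\<open>detail\<close>).  By the same rule its marginals on proper subsets cancel, so
  it does lie in \<open>H n B\<close> (\<open>detail_in_H\<close>).

  The dimensions follow by counting.  The decomposition gives \<open>|A|! = \<Sum>\<^sub>B dim (H n B)\<close>; sorting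
  the permutations of \<open>A\<close> by the set of moved points gives the same recursion for the
  derangement numbers, and a recursion over proper subsets has only one solution.
\<close>

section \<open>Erasing letters of injective words\<close>

abbreviation restrict_word :: "'a set \<Rightarrow> 'a list \<Rightarrow> 'a list"
  where "restrict_word B \<equiv> filter (\<lambda>x. x \<in> B)"

lemma restrict_word_in_words:
  assumes "\<sigma> \<in> words A" and "B \<subseteq> A"
  shows "restrict_word B \<sigma> \<in> words B"
  using assms by (auto simp: permutations_of_set_def)

text \<open>
  A subword with prescribed content is determined by erasing the other letters; this is what
  turns marginals into pushforwards.
\<close>

lemma subseq_iff_restrict_word:
  assumes "\<sigma> \<in> words A" and "\<pi> \<in> words B" and "B \<subseteq> A"
  shows "subseq \<pi> \<sigma> \<longleftrightarrow> restrict_word B \<sigma> = \<pi>"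
proof
  assume "subseq \<pi> \<sigma>"
  then have "subseq (restrict_word B \<pi>) (restrict_word B \<sigma>)"
    by (rule subseq_filter)
  moreover have "restrict_word B \<pi> = \<pi>"
    using assms(2) by (auto simp: permutations_of_set_def intro: filter_True)
  moreover have "length (restrict_word B \<sigma>) = length \<pi>"
    using restrict_word_in_words[OF assms(1,3)] assms(2)
    by (metis length_finite_permutations_of_set)
  ultimately show "restrict_word B \<sigma> = \<pi>"
    using subseq_same_length by metis
qed auto

text \<open>
  In a word without repetitions the first letter of a non-empty block fixes the position of the
  block.
\<close>

lemma append_block_inject:
  assumes "distinct (us @ \<pi> @ vs)" and "\<pi> \<noteq> []" and "us @ \<pi> @ vs = us' @ \<pi> @ vs'"
  shows "us = us' \<and> vs = vs'"
proof -
  obtain x xs where \<pi>: "\<pi> = x # xs"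
    using assms(2) by (cases \<pi>) auto
  have "distinct (us' @ \<pi> @ vs')"
    using assms(1,3) by simp
  then have "x \<notin> set us" "x \<notin> set vs" "x \<notin> set us'"
    using assms(1) \<pi> by auto
  moreover have "x \<notin> set xs"
    using assms(1) \<pi> by auto
  ultimately have "us = us' \<and> xs @ vs = xs @ vs'"
    using assms(3) append_Cons_eq_iff[of x us "xs @ vs" us' "xs @ vs'"] unfolding \<pi> by simp
  then show ?thesis by simp
qed

lemma fibre_of_letter_removal:
  assumes "a \<in> A" and "\<sigma>' \<in> words (A - {a})"
  shows "bij_betw (\<lambda>i. take i \<sigma>' @ a # drop i \<sigma>') {..length \<sigma>'}
           {\<sigma> \<in> words A. restrict_word (A - {a}) \<sigma> = \<sigma>'}"
  (is "bij_betw ?ins _ ?S")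
proof (rule bij_betw_imageI)
  have \<sigma>': "distinct \<sigma>'" "set \<sigma>' = A - {a}"
    using assms(2) by (auto simp: permutations_of_set_def)
  have a: "a \<notin> set (take i \<sigma>')" "a \<notin> set (drop i \<sigma>')" for i
    using \<sigma>' in_set_takeD in_set_dropD by fastforce+
  show "inj_on ?ins {..length \<sigma>'}"
  proof (rule inj_onI)
    fix i j assume *: "i \<in> {..length \<sigma>'}" "j \<in> {..length \<sigma>'}" "?ins i = ?ins j"
    then have "take i \<sigma>' = take j \<sigma>'"
      using a by (simp add: append_Cons_eq_iff)
    then have "length (take i \<sigma>') = length (take j \<sigma>')" by simp
    with * show "i = j" by simp
  qed
  show "?ins ` {..length \<sigma>'} = ?S"
  proof
    show "?ins ` {..length \<sigma>'} \<subseteq> ?S"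
    proof (rule image_subsetI)
      fix i
      have s: "set (take i \<sigma>') \<union> set (drop i \<sigma>') = A - {a}"
        using \<sigma>' by (metis append_take_drop_id set_append)
      have d: "distinct (take i \<sigma>' @ drop i \<sigma>')"
        using \<sigma>' by simp
      have "restrict_word (A - {a}) (take i \<sigma>') = take i \<sigma>'" 
           "restrict_word (A - {a}) (drop i \<sigma>') = drop i \<sigma>'"
        using s by (auto intro!: filter_True)
      then have "restrict_word (A - {a}) (?ins i) = \<sigma>'" by simp
      moreover have "set (?ins i) = insert a (set (take i \<sigma>') \<union> set (drop i \<sigma>'))"
        by simp
      then have "set (?ins i) = A"
        using assms(1) s by (metis insert_Diff)
      moreover have "distinct (?ins i)"
        using d a[of i] unfolding distinct_append distinct.simps list.set by blast
      ultimately have "restrict_word (A - {a}) (?ins i) = \<sigma>'" "?ins i \<in> words A"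
        by (simp_all only: permutations_of_setI)
      then show "?ins i \<in> ?S" by blast
    qed
    show "?S \<subseteq> ?ins ` {..length \<sigma>'}"
    proof
      fix \<sigma> assume \<sigma>: "\<sigma> \<in> ?S"
      then have "a \<in> set \<sigma>" "distinct \<sigma>" "set \<sigma> = A"
        using assms(1) by (auto simp: permutations_of_set_def)
      then obtain p q where pq: "\<sigma> = p @ a # q"
        by (meson split_list)
      have "restrict_word (A - {a}) p = p" "restrict_word (A - {a}) q = q"
        using \<open>set \<sigma> = A\<close> \<open>distinct \<sigma>\<close> pq by (auto intro!: filter_True)
      then have "\<sigma>' = p @ q"
        using \<sigma> pq by simp
      then show "\<sigma> \<in> ?ins ` {..length \<sigma>'}"
        using pq by (intro image_eqI[of _ _ "length p"]) auto
    qed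
  qed
qed

lemma sublist_insert_iff:
  assumes "a \<notin> set \<pi>" "a \<notin> set p" "a \<notin> set q"
  shows "sublist \<pi> (p @ a # q) \<longleftrightarrow> sublist \<pi> p \<or> sublist \<pi> q"
proof
  assume "sublist \<pi> (p @ a # q)"
  then obtain us vs where *: "p @ a # q = us @ \<pi> @ vs"
    by (auto simp: sublist_def)
  then have "a \<in> set us \<or> a \<in> set vs"
    using assms(1) by (metis in_set_conv_decomp set_append Un_iff)
  then show "sublist \<pi> p \<or> sublist \<pi> q"
  proof
    assume "a \<in> set us"
    then obtain u1 u2 where us: "us = u1 @ a # u2" by (meson split_list)
    then have "p @ a # q = u1 @ a # (u2 @ \<pi> @ vs)" using * by simp
    then have "q = u2 @ \<pi> @ vs"
      using assms by (metis append_Cons_eq_iff)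
    then show ?thesis by auto
  next
    assume "a \<in> set vs"
    then obtain v1 v2 where vs: "vs = v1 @ a # v2" by (meson split_list)
    then have "p @ a # q = (us @ \<pi> @ v1) @ a # v2" using * by simp
    then have "p = us @ \<pi> @ v1"
      using assms by (metis append_Cons_eq_iff)
    then show ?thesis by auto
  qed
next
  assume "sublist \<pi> p \<or> sublist \<pi> q"
  then show "sublist \<pi> (p @ a # q)"
    by (meson sublist_append_leftI sublist_append_rightI sublist_order.order.trans
        sublist_Cons_right)
qed

text \<open>
  There are \<open>card A\<close> places for the letter \<open>a\<close>, and all but the \<open>length \<pi> - 1\<close> gaps inside
  the block \<open>\<pi>\<close> are admissible.  The truncated subtraction gives the right count for the empty
  block, which has no inner gaps.
\<close>

lemma card_insertions_keeping_block:
  assumes "finite A" and "a \<in> A" and "\<sigma>' \<in> words (A - {a})" and "a \<notin> set \<pi>" and "sublist \<pi> \<sigma>'"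
  shows "card {\<sigma> \<in> words A. restrict_word (A - {a}) \<sigma> = \<sigma>' \<and> sublist \<pi> \<sigma>}
           = card A - (length \<pi> - 1)"
proof -
  let ?ins = "\<lambda>i. take i \<sigma>' @ a # drop i \<sigma>'"
  let ?I = "{i \<in> {..length \<sigma>'}. sublist \<pi> (take i \<sigma>') \<or> sublist \<pi> (drop i \<sigma>')}"
  have \<sigma>': "distinct \<sigma>'" "set \<sigma>' = A - {a}"
    using assms(3) by (auto simp: permutations_of_set_def)
  have a: "a \<notin> set (take i \<sigma>')" "a \<notin> set (drop i \<sigma>')" for i
    using \<sigma>' in_set_takeD in_set_dropD by fastforce+
  have len: "card A = Suc (length \<sigma>')"
    using \<sigma>' assms(1,2) by (metis card.remove distinct_card)
  have bij: "bij_betw ?ins {..length \<sigma>'} {\<sigma> \<in> words A. restrict_word (A - {a}) \<sigma> = \<sigma>'}"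
    by (rule fibre_of_letter_removal[OF assms(2,3)])
  have sub: "sublist \<pi> (?ins i) \<longleftrightarrow> sublist \<pi> (take i \<sigma>') \<or> sublist \<pi> (drop i \<sigma>')" for i
    using sublist_insert_iff a assms(4) by metis
  have "{\<sigma> \<in> words A. restrict_word (A - {a}) \<sigma> = \<sigma>' \<and> sublist \<pi> \<sigma>} = ?ins ` ?I"
  proof -
    have "{\<sigma> \<in> words A. restrict_word (A - {a}) \<sigma> = \<sigma>' \<and> sublist \<pi> \<sigma>}
            = {\<sigma> \<in> ?ins ` {..length \<sigma>'}. sublist \<pi> \<sigma>}"
      using bij_betw_imp_surj_on[OF bij] by blast
    also have "\<dots> = ?ins ` ?I"
      using sub by blast
    finally show ?thesis .
  qed
  moreover have "inj_on ?ins ?I"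
    using bij_betw_imp_inj_on[OF bij] by (rule inj_on_subset) auto
  ultimately have card: "card {\<sigma> \<in> words A. restrict_word (A - {a}) \<sigma> = \<sigma>' \<and> sublist \<pi> \<sigma>} = card ?I"
    by (simp add: card_image)
  show ?thesis
  proof (cases "\<pi> = []")
    case True
    then show ?thesis using card len by simp
  next
    case False
    obtain us vs where uv: "\<sigma>' = us @ \<pi> @ vs"
      using assms(5) by (auto simp: sublist_def)
    \<comment> \<open>the letter can go behind the block (\<open>before\<close>) or in front of it (\<open>after\<close>)\<close>
    have before: "sublist \<pi> (take i \<sigma>') \<longleftrightarrow> length us + length \<pi> \<le> i" if "i \<le> length \<sigma>'" for i
    proof
      assume "sublist \<pi> (take i \<sigma>')"
      then obtain u v where t: "take i \<sigma>' = u @ \<pi> @ v" by (auto simp: sublist_def)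
      then have "us @ \<pi> @ vs = u @ \<pi> @ (v @ drop i \<sigma>')"
        by (metis append.assoc append_take_drop_id uv)
      then have "us = u"
        using append_block_inject[of us \<pi> vs u "v @ drop i \<sigma>'"] False \<sigma>'(1) uv by blast
      moreover have "length (take i \<sigma>') = i" using that by simp
      ultimately show "length us + length \<pi> \<le> i" using t by simp
    next
      assume "length us + length \<pi> \<le> i"
      then show "sublist \<pi> (take i \<sigma>')" by (simp add: uv)
    qed
    have after: "sublist \<pi> (drop i \<sigma>') \<longleftrightarrow> i \<le> length us" if "i \<le> length \<sigma>'" for i
    proof
      assume "sublist \<pi> (drop i \<sigma>')"
      then obtain u v where t: "drop i \<sigma>' = u @ \<pi> @ v" by (auto simp: sublist_def)
      then have "us @ \<pi> @ vs = (take i \<sigma>' @ u) @ \<pi> @ v"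
        by (metis append.assoc append_take_drop_id uv)
      then have "us = take i \<sigma>' @ u"
        using append_block_inject[of us \<pi> vs "take i \<sigma>' @ u" v] False \<sigma>'(1) uv by blast
      then show "i \<le> length us" using that by simp
    next
      assume "i \<le> length us"
      then show "sublist \<pi> (drop i \<sigma>')" by (simp add: uv)
    qed
    have "?I = {..length us} \<union> {length us + length \<pi>..length \<sigma>'}"
    proof (rule set_eqI)
      fix i
      have len: "length us + length \<pi> \<le> length \<sigma>'" by (simp add: uv)
      show "i \<in> ?I \<longleftrightarrow> i \<in> {..length us} \<union> {length us + length \<pi>..length \<sigma>'}"
        using before[of i] after[of i] len by (cases "i \<le> length \<sigma>'") auto
    qed
    moreover have "{..length us} \<inter> {length us + length \<pi>..length \<sigma>'} = {}"
      using False by auto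
    ultimately have "card ?I = Suc (length us) + Suc (length vs)"
      by (simp add: card_Un_disjoint uv)
    moreover have "length \<pi> \<ge> 1" using False by (cases \<pi>) auto
    ultimately show ?thesis using card len by (simp add: uv)
  qed
qed

text \<open>
  The block \<open>\<pi>\<close> contains \<open>a\<close>, so its remaining letters already stand side by side in
  \<open>\<sigma>'\<close> and the place for \<open>a\<close> is forced.  For \<open>B = {a}\<close> no letters remain, and every place would
  do.
\<close>

lemma card_insertions_completing_block:
  assumes "a \<in> A" and "\<sigma>' \<in> words (A - {a})" and "\<pi> \<in> words B" and "a \<in> B" and "B \<subseteq> A"
    and "B \<noteq> {a}"
  shows "card {\<sigma> \<in> words A. restrict_word (A - {a}) \<sigma> = \<sigma>' \<and> sublist \<pi> \<sigma>}
           = (if sublist (restrict_word (B - {a}) \<pi>) \<sigma>' then 1 else 0)"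
proof -
  let ?S = "{\<sigma> \<in> words A. restrict_word (A - {a}) \<sigma> = \<sigma>' \<and> sublist \<pi> \<sigma>}"
  have \<sigma>': "distinct \<sigma>'" "set \<sigma>' = A - {a}"
    using assms(2) by (auto simp: permutations_of_set_def)
  have \<pi>: "distinct \<pi>" "set \<pi> = B"
    using assms(3) by (auto simp: permutations_of_set_def)
  obtain p q where pq: "\<pi> = p @ a # q"
    using \<pi> assms(4) by (meson split_list)
  have rid: "restrict_word (C - {a}) xs = xs" if "set xs \<subseteq> C" "a \<notin> set xs" for C xs
    using that by (auto intro!: filter_True)
  have pq_notin: "a \<notin> set p" "a \<notin> set q" using \<pi>(1) pq by auto
  have pqB: "set p \<subseteq> B" "set q \<subseteq> B" using \<pi>(2) pq by auto
  have r: "restrict_word (B - {a}) \<pi> = p @ q"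
    using pq_notin pqB rid[of p B] rid[of q B] pq by simp
  have ne: "p @ q \<noteq> []"
    using assms(6) \<pi>(2) pq by auto
  have decomp: "\<exists>u v. \<sigma> = u @ \<pi> @ v \<and> \<sigma>' = u @ (p @ q) @ v" if "\<sigma> \<in> ?S" for \<sigma>
  proof -
    from that obtain u v where uv: "\<sigma> = u @ \<pi> @ v" by (auto simp: sublist_def)
    have d: "distinct \<sigma>" "set \<sigma> = A" using that by (auto simp: permutations_of_set_def)
    then have "a \<notin> set u" "a \<notin> set v" "set u \<subseteq> A" "set v \<subseteq> A" using uv pq by auto
    then have "restrict_word (A - {a}) \<sigma> = u @ (p @ q) @ v"
    proof -
      have "set p \<subseteq> A" "set q \<subseteq> A" using pqB assms(5) by auto
      then have "restrict_word (A - {a}) p = p" "restrict_word (A - {a}) q = q"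
          "restrict_word (A - {a}) u = u" "restrict_word (A - {a}) v = v"
        using rid pq_notin \<open>a \<notin> set u\<close> \<open>a \<notin> set v\<close> \<open>set u \<subseteq> A\<close> \<open>set v \<subseteq> A\<close> by blast+
      then show ?thesis unfolding uv pq by simp
    qed
    moreover have "restrict_word (A - {a}) \<sigma> = \<sigma>'" using that by simp
    ultimately show ?thesis using uv by metis
  qed
  show ?thesis
  proof (cases "sublist (p @ q) \<sigma>'")
    case False
    have "?S = {}"
    proof (rule equals0I)
      fix \<sigma> assume "\<sigma> \<in> ?S"
      then show False using decomp False sublist_appendI by metis
    qed
    then show ?thesis using False r by (simp del: Collect_empty_eq)
  next
    case True
    then obtain u v where uv: "\<sigma>' = u @ (p @ q) @ v" by (auto simp: sublist_def)
    have "u @ \<pi> @ v \<in> ?S"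
    proof -
      have sets: "set u \<subseteq> A - {a}" "set v \<subseteq> A - {a}" "set p \<subseteq> A - {a}" "set q \<subseteq> A - {a}"
        using \<sigma>'(2) uv by auto
      have "restrict_word (A - {a}) (u @ \<pi> @ v) = \<sigma>'"
      proof -
        have "restrict_word (A - {a}) u = u" "restrict_word (A - {a}) v = v"
            "restrict_word (A - {a}) p = p" "restrict_word (A - {a}) q = q"
          using sets by (meson filter_True subsetD)+
        then show ?thesis unfolding uv pq by simp
      qed
      moreover have "distinct (u @ \<pi> @ v)"
      proof -
        have "distinct (u @ p @ q @ v)" "a \<notin> set (u @ p @ q @ v)"
          using \<sigma>'(1) uv sets by auto
        then show ?thesis unfolding pq by auto
      qed
      moreover have "set (u @ \<pi> @ v) = A"
      proof -
        have "set (u @ \<pi> @ v) = insert a (set \<sigma>')" unfolding uv pq by auto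
        then show ?thesis using \<sigma>'(2) assms(1) by (metis insert_Diff)
      qed
      ultimately show ?thesis
        by (simp add: permutations_of_setI)
    qed
    moreover have "\<sigma> = u @ \<pi> @ v" if in_S: "\<sigma> \<in> ?S" for \<sigma>
    proof -
      obtain u' v' where u'v': "\<sigma> = u' @ \<pi> @ v'" "\<sigma>' = u' @ (p @ q) @ v'"
        using decomp[OF in_S] by blast
      then have "u = u' \<and> v = v'"
        using append_block_inject[of u "p @ q" v u' v'] ne \<sigma>'(1) uv by metis
      then show ?thesis using u'v' by simp
    qed
    ultimately have "?S = {u @ \<pi> @ v}" by blast
    then have "card ?S = 1" by simp
    then show ?thesis using True r by simp
  qed
qed

section \<open>Direct sums and dimensions\<close>

text \<open>
  The space of all functions on words has infinite dimension, so dimensions of subspaces are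
  compared here, and in \<open>dim_direct_sum\<close>, by transporting explicit bases.
\<close>

lemma dim_linear_image:
  fixes f :: "'a::real_vector \<Rightarrow> 'b::real_vector"
  assumes "linear f" and "subspace S" and "inj_on f S"
  shows "dim (f ` S) = dim S"
proof -
  obtain B where B: "B \<subseteq> S" "independent B" "S \<subseteq> span B" "card B = dim S"
    by (rule basis_exists)
  have span: "span B = S"
    using B assms(2) by (simp add: span_minimal subset_antisym)
  have "independent (f ` B)"
    using linear_independent_injective_image[OF assms(1) B(2)] assms(3) span by simp
  moreover have "f ` S \<subseteq> span (f ` B)"
    using linear_span_image[OF assms(1), of B] span by simp
  moreover have "card (f ` B) = dim S"
    using B assms(3) by (metis card_image inj_on_subset)
  ultimately show ?thesis
    using B(1) by (intro dim_unique[of "f ` B"]) auto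
qed

lemma direct_sum_zero:
  assumes "is_direct_sum V I W" and "w \<in> (\<Pi> i\<in>I. W i)" and "(\<Sum>i\<in>I. w i) = 0" and "i \<in> I"
  shows "w i = 0"
proof -
  have sub: "subspace (W j)" if "j \<in> I" for j
    using assms(1) that by (simp add: is_direct_sum_def)
  let ?z = "\<lambda>j\<in>I. 0"
  have "0 \<in> V"
    using assms(1) by (simp add: is_direct_sum_def subspace_0)
  have "\<forall>v\<in>V. \<exists>!w. w \<in> (\<Pi>\<^sub>E i\<in>I. W i) \<and> v = (\<Sum>i\<in>I. w i)"
    using assms(1) unfolding is_direct_sum_def by (elim conjE)
  from bspec[OF this \<open>0 \<in> V\<close>]
  have "\<exists>!w. w \<in> (\<Pi>\<^sub>E i\<in>I. W i) \<and> 0 = (\<Sum>i\<in>I. w i)" .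
  moreover have "?z \<in> (\<Pi>\<^sub>E i\<in>I. W i)" "0 = (\<Sum>i\<in>I. ?z i)"
    using sub by (auto simp: subspace_0)
  moreover have "restrict w I \<in> (\<Pi>\<^sub>E i\<in>I. W i)" "0 = (\<Sum>i\<in>I. restrict w I i)"
    using assms(2,3) by auto
  ultimately have "restrict w I = ?z" by blast
  then show ?thesis using assms(4) by (metis restrict_apply)
qed

text \<open>
  The union of bases of the summands is a basis of the sum; the spanning set guarantees that these
  bases are finite.
\<close>

lemma dim_direct_sum:
  assumes ds: "is_direct_sum V I W" and fin: "V \<subseteq> span S" "finite S"
  shows "dim V = (\<Sum>i\<in>I. dim (W i))"
proof -
  have I: "finite I" and W: "\<And>i. i \<in> I \<Longrightarrow> subspace (W i)" "\<And>i. i \<in> I \<Longrightarrow> W i \<subseteq> V"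
    using ds by (auto simp: is_direct_sum_def)
  have "\<exists>b. b \<subseteq> W i \<and> independent b \<and> W i \<subseteq> span b \<and> card b = dim (W i)" for i
    using basis_exists by metis
  then obtain b where b: "\<And>i. b i \<subseteq> W i" "\<And>i. independent (b i)" "\<And>i. W i \<subseteq> span (b i)"
      "\<And>i. card (b i) = dim (W i)"
    by metis
  have fb: "finite (b i)" if "i \<in> I" for i
    using independent_span_bound[OF fin(2) b(2)] b(1) W(2)[OF that] fin(1) by blast
  have disj: "b i \<inter> b j = {}" if ij: "i \<in> I" "j \<in> I" "i \<noteq> j" for i j
  proof (rule ccontr)
    assume "b i \<inter> b j \<noteq> {}"
    then obtain x where x: "x \<in> b i" "x \<in> b j" by auto
    \<comment> \<open>a common basis vector \<open>x\<close> would decompose \<open>0\<close> nontrivially as \<open>x + (- x)\<close>\<close>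
    let ?w = "\<lambda>k. if k = i then x else if k = j then - x else 0"
    have "?w \<in> (\<Pi> i\<in>I. W i)"
      using x b(1) W(1) ij by (auto simp: subspace_0 subspace_neg subset_iff)
    moreover have "(\<Sum>k\<in>I. ?w k) = 0"
    proof -
      have "(\<Sum>k\<in>I. ?w k) = (\<Sum>k\<in>I. (if k = i then x else 0) + (if k = j then - x else 0))"
        using ij(3) by (intro sum.cong) auto
      then show ?thesis using I ij by (simp add: sum.distrib)
    qed
    ultimately have "?w i = 0"
      using direct_sum_zero[OF ds _ _ ij(1)] by blast
    then show False using x(1) b(2) dependent_zero by auto
  qed
  let ?B = "\<Union>i\<in>I. b i"
  have fB: "finite ?B" using I fb by auto
  have "independent ?B"
  proof (subst dependent_finite[OF fB], safe)
    fix u x i assume u: "(\<Sum>v\<in>?B. u v *\<^sub>R v) = 0" and x: "i \<in> I" "x \<in> b i" "u x \<noteq> 0"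
    let ?w = "\<lambda>i. \<Sum>v\<in>b i. u v *\<^sub>R v"
    have "(\<Sum>i\<in>I. ?w i) = 0"
      using u I fb disj by (subst (asm) sum.UNION_disjoint) auto
    moreover have "?w \<in> (\<Pi> i\<in>I. W i)"
      using b(1) W(1) by (auto intro!: subspace_sum subspace_scale)
    ultimately have "?w i = 0"
      using direct_sum_zero[OF ds _ _ x(1)] by blast
    then show False
      using b(2)[of i] x dependent_finite[OF fb[OF x(1)]] by blast
  qed
  moreover have "?B \<subseteq> V" using b(1) W(2) by blast
  moreover have "V \<subseteq> span ?B"
  proof
    fix v assume "v \<in> V"
    then obtain w where w: "w \<in> (\<Pi>\<^sub>E i\<in>I. W i)" "v = (\<Sum>i\<in>I. w i)"
      using ds unfolding is_direct_sum_def by (elim conjE) (drule (1) bspec, elim ex1E conjE)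
    have "w i \<in> span ?B" if "i \<in> I" for i
    proof -
      have "w i \<in> span (b i)" using w(1) that b(3) by blast
      then show ?thesis using span_mono[of "b i" ?B] that by blast
    qed
    then show "v \<in> span ?B" using w(2) by (simp add: span_sum)
  qed
  moreover have "card ?B = (\<Sum>i\<in>I. dim (W i))"
    using I fb disj b(4) by (subst card_UN_disjoint) auto
  ultimately show ?thesis by (intro dim_unique)
qed

lemma sum_fun_apply: "(\<Sum>i\<in>I. f i) x = (\<Sum>i\<in>I. f i x)"
  by (induction I rule: infinite_finite_induct) auto

lemma L_eq_span_diracs:
  assumes "finite E"
  shows "L E = span (dirac ` E)"
proof
  show "L E \<subseteq> span (dirac ` E)"
  proof
    fix F :: "'a \<Rightarrow> real" assume F: "F \<in> L E"
    have "F = (\<Sum>x\<in>E. F x *\<^sub>R dirac x)"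
    proof
      fix y
      have "(\<Sum>x\<in>E. F x *\<^sub>R dirac x) y = (\<Sum>x\<in>E. F x * indicator {x} y)"
        by (simp add: sum_fun_apply scaleR_fun_def)
      also have "\<dots> = (\<Sum>x\<in>E. if x = y then F x else 0)"
        by (intro sum.cong) (auto simp: indicator_def)
      also have "\<dots> = F y"
        using assms F by (auto simp: L_def)
      finally show "F y = (\<Sum>x\<in>E. F x *\<^sub>R dirac x) y" by simp
    qed
    then show "F \<in> span (dirac ` E)"
      by (metis (no_types, lifting) imageI span_base span_scale span_sum)
  qed
  have "subspace (L E)"
    by (auto simp: subspace_def L_def scaleR_fun_def)
  moreover have "dirac x \<in> L E" if "x \<in> E" for x
    using that by (simp add: L_def) (metis indicator_simps(2) singletonD)
  ultimately show "span (dirac ` E) \<subseteq> L E"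
    by (intro span_minimal image_subsetI)
qed

lemma dim_L:
  assumes "finite E"
  shows "dim (L E) = card E"
proof -
  have inj: "inj_on (dirac :: 'a \<Rightarrow> 'a \<Rightarrow> real) E"
    by (intro inj_onI) (metis indicator_eq_1_iff singleton_iff)
  have "independent (dirac ` E :: ('a \<Rightarrow> real) set)"
  proof (subst dependent_finite, use assms in simp, safe)
    fix u :: "('a \<Rightarrow> real) \<Rightarrow> real" and y
    assume u: "(\<Sum>v\<in>dirac ` E. u v *\<^sub>R v) = 0" and y: "y \<in> E" "u (dirac y) \<noteq> 0"
    have "0 = (\<Sum>x\<in>E. u (dirac x) *\<^sub>R dirac x) y"
      using u inj by (simp add: sum.reindex o_def)
    also have "\<dots> = (\<Sum>x\<in>E. if x = y then u (dirac x) else 0)"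
      unfolding sum_fun_apply by (intro sum.cong) (auto simp: indicator_def scaleR_fun_def)
    also have "\<dots> = u (dirac y)" using assms y by simp
    finally show False using y by simp
  qed
  then show ?thesis
    using L_eq_span_diracs[OF assms] inj
    by (simp add: dim_eq_card_independent card_image)
qed

section \<open>Derangements and index sets\<close>

lemma finite_Subsets2_bar: "finite A \<Longrightarrow> finite (Subsets2_bar A)"
  by (simp add: Subsets2_bar_def Subsets2_def)

lemma mem_Subsets2_bar_iff:
  assumes "finite A"
  shows "B \<in> Subsets2_bar A \<longleftrightarrow> B \<subseteq> A \<and> card B \<noteq> 1"
proof -
  have "card B = 0 \<longleftrightarrow> B = {}" if "B \<subseteq> A"
    using that assms finite_subset by (metis card_0_eq)
  then show ?thesis
    unfolding Subsets2_bar_def Subsets2_def by fastforce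
qed

text \<open>
  Each permutation of \<open>A\<close> is a derangement of the set of points that it moves.
\<close>

lemma card_permutations_by_support:
  assumes "finite A"
  shows "fact (card A) = (\<Sum>C\<in>Pow A. derangement_number (card C))"
proof -
  let ?D = "\<lambda>C. {p. p permutes C \<and> (\<forall>x\<in>C. p x \<noteq> x)}"
  have D: "card (?D C) = derangement_number (card C)" if "C \<subseteq> A" for C
  proof -
    have "finite C" using assms that finite_subset by blast
    then obtain h where "bij_betw h {1..card C} C"
      using ex_bij_betw_nat_finite_1 by blast
    from bij_betw_same_card[OF bij_betw_derangements[OF this]]
    show ?thesis by (simp add: derangement_number_def)
  qed
  have supp: "{x. p x \<noteq> x} = C" if "p \<in> ?D C" for p C
    using that by (auto simp: permutes_def)
  have "{p. p permutes A} = (\<Union>C\<in>Pow A. ?D C)"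
  proof
    show "{p. p permutes A} \<subseteq> (\<Union>C\<in>Pow A. ?D C)"
    proof
      fix p assume "p \<in> {p. p permutes A}"
      then have p: "p permutes A" by simp
      let ?C = "{x. p x \<noteq> x}"
      have "?C \<subseteq> A" using p by (auto simp: permutes_def)
      moreover have "p permutes ?C"
        by (rule permutes_superset[OF p]) auto
      ultimately show "p \<in> (\<Union>C\<in>Pow A. ?D C)" by blast
    qed
    show "(\<Union>C\<in>Pow A. ?D C) \<subseteq> {p. p permutes A}"
      by (auto intro: permutes_subset)
  qed
  then have "card {p. p permutes A} = card (\<Union>C\<in>Pow A. ?D C)" by simp
  also have "\<dots> = (\<Sum>C\<in>Pow A. card (?D C))"
  proof (rule card_UN_disjoint)
    show "\<forall>C\<in>Pow A. finite (?D C)"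
      using assms by (auto intro: finite_subset[OF _ finite_permutations] finite_subset[of _ A])
    show "\<forall>C\<in>Pow A. \<forall>C'\<in>Pow A. C \<noteq> C' \<longrightarrow> ?D C \<inter> ?D C' = {}"
      using supp by blast
  qed (use assms in simp)
  finally show ?thesis using D card_permutations[OF refl assms] by simp
qed

lemma derangement_number_1: "derangement_number 1 = 0"
  by (simp add: derangement_number_def)

text \<open>
  Singletons can be left out since they have no derangements.
\<close>

lemma fact_eq_sum_derangements:
  assumes "finite A"
  shows "fact (card A) = (\<Sum>C\<in>Subsets2_bar A. derangement_number (card C))"
proof -
  have "(\<Sum>C\<in>Subsets2_bar A. derangement_number (card C)) = (\<Sum>C\<in>Pow A. derangement_number (card C))"
    using assms by (intro sum.mono_neutral_left)
      (auto simp: mem_Subsets2_bar_iff derangement_number_1[simplified])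
  then show ?thesis using card_permutations_by_support[OF assms] by simp
qed

section \<open>Marginals as pushforwards\<close>

text \<open>
  The operator \<open>marginal n B\<close> on \<open>L (words A)\<close>, seen as a pushforward.  For a singleton \<open>B\<close> the
  total mass sits at the one-letter word rather than at \<open>[]\<close>; with this choice marginals compose
  along every chain of subsets, also through singletons.
\<close>

definition word_marginal :: "nat set \<Rightarrow> nat set \<Rightarrow> (nat list \<Rightarrow> real) \<Rightarrow> nat list \<Rightarrow> real"
  where "word_marginal A B F = (\<lambda>\<pi>. \<Sum>\<sigma> | \<sigma> \<in> words A \<and> restrict_word B \<sigma> = \<pi>. F \<sigma>)"

lemma word_marginal_in_L:
  assumes "B \<subseteq> A"
  shows "word_marginal A B F \<in> L (words B)"
proof -
  have "{\<sigma> \<in> words A. restrict_word B \<sigma> = \<pi>} = {}" if "\<pi> \<notin> words B" for \<pi>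
    using restrict_word_in_words[OF _ assms] that by auto
  then show ?thesis
    unfolding L_def word_marginal_def by (auto simp del: Collect_empty_eq)
qed

lemma word_marginal_add: "word_marginal A B (F + G) = word_marginal A B F + word_marginal A B G"
  by (auto simp: word_marginal_def sum.distrib)

lemma word_marginal_scale: "word_marginal A B (c *\<^sub>R F) = c *\<^sub>R word_marginal A B F"
  by (auto simp: word_marginal_def scaleR_fun_def sum_distrib_left)

lemma linear_word_marginal: "linear (word_marginal A B)"
  by (intro linearI word_marginal_add word_marginal_scale)

lemma word_marginal_self:
  assumes "F \<in> L (words A)"
  shows "word_marginal A A F = F"
proof
  fix \<pi>
  have "restrict_word A \<sigma> = \<sigma>" if "\<sigma> \<in> words A" for \<sigma>
    using that by (auto simp: permutations_of_set_def intro: filter_True)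
  then have "{\<sigma> \<in> words A. restrict_word A \<sigma> = \<pi>} = (if \<pi> \<in> words A then {\<pi>} else {})"
    by auto
  then show "word_marginal A A F \<pi> = F \<pi>"
    using assms unfolding word_marginal_def L_def by (simp del: Collect_empty_eq)
qed

lemma word_marginal_trans:
  assumes "D \<subseteq> C" and "C \<subseteq> A"
  shows "word_marginal C D (word_marginal A C F) = word_marginal A D F"
proof
  fix \<rho>
  let ?S = "{\<sigma> \<in> words A. restrict_word D \<sigma> = \<rho>}" and ?T = "{\<pi> \<in> words C. restrict_word D \<pi> = \<rho>}"
  have res: "restrict_word D (restrict_word C \<sigma>) = restrict_word D \<sigma>" for \<sigma>
    using assms(1) by (auto intro!: filter_cong)
  have "(\<Sum>\<pi>\<in>?T. \<Sum>\<sigma> | \<sigma> \<in> words A \<and> restrict_word C \<sigma> = \<pi>. F \<sigma>)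
      = (\<Sum>\<pi>\<in>?T. \<Sum>\<sigma> | \<sigma> \<in> ?S \<and> restrict_word C \<sigma> = \<pi>. F \<sigma>)"
    using res by (intro sum.cong refl Collect_cong) auto
  also have "\<dots> = (\<Sum>\<sigma>\<in>?S. F \<sigma>)"
    using restrict_word_in_words[OF _ assms(2)] res by (intro sum.group) auto
  finally show "word_marginal C D (word_marginal A C F) \<rho> = word_marginal A D F \<rho>"
    unfolding word_marginal_def .
qed

section \<open>Synthesis by contiguous blocks\<close>

text \<open>
  The operator \<open>synth n A\<close> on \<open>L (words B)\<close>.  Because of the truncated subtraction, one factorial
  covers both clauses of the definition: \<open>card A - card B + 1\<close> movable pieces (the block and the
  letters outside it) for non-empty \<open>B\<close>, and \<open>card A\<close> of them for empty \<open>B\<close>.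
\<close>

definition block_extension :: "nat set \<Rightarrow> nat set \<Rightarrow> (nat list \<Rightarrow> real) \<Rightarrow> nat list \<Rightarrow> real"
  where "block_extension A B F =
    (\<lambda>\<sigma>. if \<sigma> \<in> words A
      then (\<Sum>\<pi> | \<pi> \<in> words B \<and> sublist \<pi> \<sigma>. F \<pi>) / fact (card A - (card B - 1)) else 0)"

lemma block_extension_in_L: "block_extension A B F \<in> L (words A)"
  by (simp add: block_extension_def L_def)

lemma block_extension_not_subset:
  assumes "\<not> B \<subseteq> A"
  shows "block_extension A B F = 0"
proof
  fix \<sigma>
  have "{\<pi> \<in> words B. sublist \<pi> \<sigma>} = {}" if "\<sigma> \<in> words A"
    using assms that set_mono_sublist by (fastforce simp: permutations_of_set_def)
  then show "block_extension A B F \<sigma> = 0 \<sigma>"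
    unfolding block_extension_def by (simp del: Collect_empty_eq)
qed

lemma block_extension_self:
  assumes "F \<in> L (words B)"
  shows "block_extension B B F = F"
proof
  fix \<sigma>
  have "{\<pi> \<in> words B. sublist \<pi> \<sigma>} = {\<sigma>}" if "\<sigma> \<in> words B"
  proof -
    have "\<pi> = \<sigma>" if "\<pi> \<in> words B" "sublist \<pi> \<sigma>" for \<pi>
      using that \<open>\<sigma> \<in> words B\<close>
      by (metis length_finite_permutations_of_set sublist_imp_subseq subseq_same_length)
    then show ?thesis using that by auto
  qed
  moreover have "fact (card B - (card B - 1)) = (1 :: real)"
    by (cases "card B") auto
  ultimately show "block_extension B B F \<sigma> = F \<sigma>"
    using assms by (simp add: block_extension_def L_def)
qed

text \<open>
  Exchanging the sums reduces the claim to counting, for each block \<open>\<pi>\<close>, the ways to reinsert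
  \<open>a\<close> into \<open>\<sigma>'\<close> such that \<open>\<pi>\<close> appears as a block.
\<close>

lemma word_marginal_remove_letter_block_extension:
  assumes "finite A" and "a \<in> A" and "B \<noteq> {a}"
    and zero: "a \<in> B \<Longrightarrow> word_marginal B (B - {a}) F = 0"
  shows "word_marginal A (A - {a}) (block_extension A B F) = block_extension (A - {a}) B F"
proof (cases "B \<subseteq> A")
  case False
  then have "\<not> B \<subseteq> A - {a}" by blast
  then show ?thesis
    using False by (simp add: block_extension_not_subset word_marginal_def fun_eq_iff)
next
  case True
  let ?c = "fact (card A - (card B - 1)) :: real"
  show ?thesis
  proof
    fix \<sigma>'
    let ?R = "{\<sigma> \<in> words A. restrict_word (A - {a}) \<sigma> = \<sigma>'}"
    let ?N = "\<lambda>\<pi>. card {\<sigma> \<in> words A. restrict_word (A - {a}) \<sigma> = \<sigma>' \<and> sublist \<pi> \<sigma>}"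
    show "word_marginal A (A - {a}) (block_extension A B F) \<sigma>' = block_extension (A - {a}) B F \<sigma>'"
    proof (cases "\<sigma>' \<in> words (A - {a})")
      case False
      then show ?thesis
        using word_marginal_in_L[of "A - {a}" A] by (auto simp: L_def block_extension_def)
    next
      case \<sigma>': True
      have "word_marginal A (A - {a}) (block_extension A B F) \<sigma>'
          = (\<Sum>\<sigma>\<in>?R. (\<Sum>\<pi>\<in>words B. if sublist \<pi> \<sigma> then F \<pi> else 0) / ?c)"
        unfolding word_marginal_def block_extension_def
        by (intro sum.cong) (auto simp: sum.inter_filter)
      also have "\<dots> = (\<Sum>\<sigma>\<in>?R. \<Sum>\<pi>\<in>words B. if sublist \<pi> \<sigma> then F \<pi> else 0) / ?c"
        by (simp add: sum_divide_distrib)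
      also have "(\<Sum>\<sigma>\<in>?R. \<Sum>\<pi>\<in>words B. if sublist \<pi> \<sigma> then F \<pi> else 0)
          = (\<Sum>\<pi>\<in>words B. \<Sum>\<sigma>\<in>?R. if sublist \<pi> \<sigma> then F \<pi> else 0)"
        by (rule sum.swap)
      also have "\<dots> = (\<Sum>\<pi>\<in>words B. ?N \<pi> * F \<pi>)"
      proof (rule sum.cong[OF refl])
        fix \<pi>
        have "(\<Sum>\<sigma>\<in>?R. if sublist \<pi> \<sigma> then F \<pi> else 0) = (\<Sum>\<sigma> | \<sigma> \<in> ?R \<and> sublist \<pi> \<sigma>. F \<pi>)"
          by (rule sum.inter_filter[symmetric]) simp
        then show "(\<Sum>\<sigma>\<in>?R. if sublist \<pi> \<sigma> then F \<pi> else 0) = ?N \<pi> * F \<pi>"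
          by (simp add: conj_assoc)
      qed
      finally have lhs: "word_marginal A (A - {a}) (block_extension A B F) \<sigma>'
          = (\<Sum>\<pi>\<in>words B. ?N \<pi> * F \<pi>) / ?c" .
      show ?thesis
      proof (cases "a \<in> B")
        case False
        let ?m = "card A - (card B - 1)"
        have N: "?N \<pi> = (if sublist \<pi> \<sigma>' then ?m else 0)" if "\<pi> \<in> words B" for \<pi>
        proof (cases "sublist \<pi> \<sigma>'")
          case True
          have "a \<notin> set \<pi>" "length \<pi> = card B"
            using that False by (auto simp: permutations_of_set_def distinct_card)
          then show ?thesis
            using card_insertions_keeping_block[OF assms(1,2) \<sigma>' _ True] True by simp
        next
          case False
          have "restrict_word (A - {a}) \<pi> = \<pi>"
            using that \<open>a \<notin> B\<close> \<open>B \<subseteq> A\<close>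
            by (auto simp: permutations_of_set_def intro!: filter_True)
          then have "sublist \<pi> (restrict_word (A - {a}) \<sigma>)" if "sublist \<pi> \<sigma>" for \<sigma>
            using that by (metis filter_append sublist_def)
          then have "{\<sigma> \<in> words A. restrict_word (A - {a}) \<sigma> = \<sigma>' \<and> sublist \<pi> \<sigma>} = {}"
            using False by blast
          then show ?thesis using False by (simp del: Collect_empty_eq)
        qed
        \<comment> \<open>the number of insertions is the factor by which the two normalising factorials differ\<close>
        have "B \<subseteq> A - {a}" using True False by blast
        then have "card B \<le> card A - 1"
          using assms(1,2) by (metis card_Diff_singleton card_mono finite_Diff)
        moreover have "card A > 0" using assms(1,2) card_gt_0_iff by blast
        ultimately have m: "?m = Suc (card (A - {a}) - (card B - 1))"
          using assms(1,2) by simp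
        have "(\<Sum>\<pi>\<in>words B. ?N \<pi> * F \<pi>) = (\<Sum>\<pi>\<in>words B. if sublist \<pi> \<sigma>' then ?m * F \<pi> else 0)"
          using N by (intro sum.cong) auto
        also have "\<dots> = ?m * (\<Sum>\<pi> | \<pi> \<in> words B \<and> sublist \<pi> \<sigma>'. F \<pi>)"
          by (simp add: sum.inter_filter[symmetric] sum_distrib_left)
        finally have "word_marginal A (A - {a}) (block_extension A B F) \<sigma>'
            = ?m * (\<Sum>\<pi> | \<pi> \<in> words B \<and> sublist \<pi> \<sigma>'. F \<pi>) / fact ?m"
          using lhs by simp
        also have "\<dots> = block_extension (A - {a}) B F \<sigma>'"
          unfolding block_extension_def m fact_Suc using \<sigma>' by (simp add: divide_simps del: of_nat_Suc)
        finally show ?thesis .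
      next
        case aB: True
        \<comment> \<open>grouping the blocks by the word \<open>\<rho>\<close> left after erasing \<open>a\<close> collects the vanishing marginal of \<open>F\<close>\<close>
        let ?P = "{\<rho> \<in> words (B - {a}). sublist \<rho> \<sigma>'}"
        have "(\<Sum>\<pi>\<in>words B. ?N \<pi> * F \<pi>)
            = (\<Sum>\<pi>\<in>words B. if sublist (restrict_word (B - {a}) \<pi>) \<sigma>' then F \<pi> else 0)"
          using card_insertions_completing_block[OF assms(2) \<sigma>' _ aB True assms(3)]
          by (intro sum.cong) auto
        also have "\<dots> = (\<Sum>\<pi> | \<pi> \<in> words B \<and> sublist (restrict_word (B - {a}) \<pi>) \<sigma>'. F \<pi>)"
          by (simp add: sum.inter_filter)
        also have "\<dots> = (\<Sum>\<rho>\<in>?P. \<Sum>\<pi> | \<pi> \<in> {\<pi> \<in> words B. sublist (restrict_word (B - {a}) \<pi>) \<sigma>'}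
              \<and> restrict_word (B - {a}) \<pi> = \<rho>. F \<pi>)"
          using restrict_word_in_words[of _ B "B - {a}"] by (intro sum.group[symmetric]) auto
        also have "\<dots> = (\<Sum>\<rho>\<in>?P. word_marginal B (B - {a}) F \<rho>)"
          unfolding word_marginal_def by (intro sum.cong refl Collect_cong) auto
        also have "\<dots> = 0"
          using zero[OF aB] by simp
        finally have "word_marginal A (A - {a}) (block_extension A B F) \<sigma>' = 0"
          using lhs by simp
        moreover have "block_extension (A - {a}) B F = 0"
          using aB by (intro block_extension_not_subset) auto
        ultimately show ?thesis by simp
      qed
    qed
  qed
qed

text \<open>
  The letters outside \<open>A'\<close> are erased one at a time.  As soon as a letter of \<open>B\<close> goes, both sides
  become zero and remain so.
\<close>

lemma word_marginal_block_extension: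
  assumes "finite A" and "A' \<subseteq> A" and "card B \<noteq> 1"
    and zero: "\<And>a. a \<in> B \<Longrightarrow> word_marginal B (B - {a}) F = 0"
  shows "word_marginal A A' (block_extension A B F) = block_extension A' B F"
proof -
  have "word_marginal A (A - C) (block_extension A B F) = block_extension (A - C) B F"
    if "finite C" "C \<subseteq> A" for C
    using that
  proof (induction C rule: finite_induct)
    case empty
    then show ?case
      by (simp add: word_marginal_self block_extension_in_L)
  next
    case (insert a C)
    have diff: "A - insert a C = A - C - {a}" by blast
    have "word_marginal A (A - insert a C) (block_extension A B F)
        = word_marginal (A - C) (A - C - {a}) (word_marginal A (A - C) (block_extension A B F))"
      unfolding diff by (rule word_marginal_trans[symmetric]) auto
    also have "\<dots> = word_marginal (A - C) (A - C - {a}) (block_extension (A - C) B F)"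
      using insert by simp
    also have "\<dots> = block_extension (A - C - {a}) B F"
      using insert assms by (intro word_marginal_remove_letter_block_extension) auto
    finally show ?case unfolding diff .
  qed
  from this[of "A - A'"] show ?thesis
    using assms(1,2) by (simp add: double_diff)
qed

section \<open>Marginals of synthesised functions\<close>

lemma finite_words_n: "finite (words_n n)"
proof -
  have "finite (Subsets2 {1..n})" by (simp add: Subsets2_def)
  then show ?thesis by (simp add: words_n_def)
qed

lemma words_subset_words_bar:
  assumes "B \<in> Subsets2_bar {1..n}"
  shows "words B \<subseteq> words_bar n"
  using assms by (auto simp: Subsets2_bar_def words_bar_def words_n_def)

lemma finite_index_set: "A \<in> Subsets2_bar {1..n::nat} \<Longrightarrow> finite A"
  by (auto simp: mem_Subsets2_bar_iff intro: finite_subset)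

lemma Subsets2_bar_trans:
  assumes "A \<in> Subsets2_bar {1..n::nat}" and "B \<in> Subsets2_bar A"
  shows "B \<in> Subsets2_bar {1..n}"
  using assms finite_index_set[OF assms(1)] by (auto simp: mem_Subsets2_bar_iff)

lemma Subsets2_bar_self: "A \<in> Subsets2_bar {1..n::nat} \<Longrightarrow> A \<in> Subsets2_bar A"
  using finite_index_set by (auto simp: mem_Subsets2_bar_iff)

lemma marginal_eq_word_marginal:
  assumes A: "A \<in> Subsets2_bar {1..n}" and F: "F \<in> L (words A)" and B: "B \<in> Subsets2_bar A"
  shows "marginal n B F = word_marginal A B F"
proof -
  have fin: "finite A" by (rule finite_index_set[OF A])
  have BA: "B \<subseteq> A" "card B \<noteq> 1" using B fin by (auto simp: mem_Subsets2_bar_iff)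
  have F0: "F \<sigma> = 0" if "\<sigma> \<notin> words A" for \<sigma> using F that by (auto simp: L_def)
  show ?thesis
  proof (cases "card B \<le> 1")
    case True
    then have "B = {}"
      using BA fin by (metis card_0_eq finite_subset le_antisym le_neq_implies_less less_one)
    have "(\<Sum>\<pi>\<in>words_bar n. F \<pi>) = (\<Sum>\<pi>\<in>words A. F \<pi>)"
      using words_subset_words_bar[OF A] F0 finite_words_n
      by (intro sum.mono_neutral_right) (auto simp: words_bar_def)
    then show ?thesis
      using \<open>B = {}\<close> by (auto simp: marginal_def word_marginal_def scaleR_fun_def fun_eq_iff indicator_def)
  next
    case False
    then have "card A \<ge> 2"
      using BA(1) card_mono[OF fin BA(1)] by simp
    then have wA: "words A \<subseteq> words_n n"
      using A by (auto simp: Subsets2_bar_def words_n_def)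
    show ?thesis
    proof
      fix \<pi>
      show "marginal n B F \<pi> = word_marginal A B F \<pi>"
      proof (cases "\<pi> \<in> words B")
        case True
        have "(\<Sum>\<sigma> | \<sigma> \<in> words_n n \<and> subseq \<pi> \<sigma>. F \<sigma>) = (\<Sum>\<sigma> | \<sigma> \<in> words A \<and> restrict_word B \<sigma> = \<pi>. F \<sigma>)"
          using wA F0 finite_words_n subseq_iff_restrict_word[OF _ True BA(1)]
          by (intro sum.mono_neutral_right) auto
        then show ?thesis using False True by (simp add: marginal_def word_marginal_def)
      next
        case False2: False
        then show ?thesis
          using False word_marginal_in_L[OF BA(1)] by (auto simp: marginal_def L_def)
      qed
    qed
  qed
qed

text \<open>
  Singletons impose the same condition as the empty set, so proper subsets in \<open>Subsets2_bar B\<close>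
  suffice.  In this form \<open>B = {}\<close> needs no separate clause.
\<close>

lemma H_altdef:
  assumes B: "B \<in> Subsets2_bar {1..n}"
  shows "H n B = {F \<in> L (words B). \<forall>C\<in>Subsets2_bar B. C \<noteq> B \<longrightarrow> word_marginal B C F = 0}"
proof (cases "B = {}")
  case True
  then show ?thesis by (auto simp: H_def mem_Subsets2_bar_iff)
next
  case False
  have fin: "finite B" by (rule finite_index_set[OF B])
  have "(\<forall>B'. B' \<subset> B \<longrightarrow> marginal n B' F = 0)
      \<longleftrightarrow> (\<forall>C\<in>Subsets2_bar B. C \<noteq> B \<longrightarrow> word_marginal B C F = 0)" if F: "F \<in> L (words B)" for F
  proof (intro iffI ballI impI allI)
    fix C assume "\<forall>B'. B' \<subset> B \<longrightarrow> marginal n B' F = 0" "C \<in> Subsets2_bar B" "C \<noteq> B"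
    then show "word_marginal B C F = 0"
      using marginal_eq_word_marginal[OF B F] fin
      by (metis mem_Subsets2_bar_iff psubsetI)
  next
    fix B' assume *: "\<forall>C\<in>Subsets2_bar B. C \<noteq> B \<longrightarrow> word_marginal B C F = 0" and "B' \<subset> B"
    let ?C = "if card B' = 1 then {} else B'"
    have "?C \<in> Subsets2_bar B" "?C \<noteq> B"
      using \<open>B' \<subset> B\<close> False fin by (auto simp: mem_Subsets2_bar_iff)
    then have "marginal n ?C F = 0"
      using * marginal_eq_word_marginal[OF B F] by metis
    then show "marginal n B' F = 0"
      by (simp add: marginal_def split: if_splits)
  qed
  then show ?thesis using False by (auto simp: H_def)
qed

lemma H_subset_L: "H n B \<subseteq> L (words B)"
  by (auto simp: H_def)

text \<open>
  When \<open>B\<close> has two elements, \<open>B - {a}\<close> is a singleton, and the vanishing of the marginal comes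
  from that of the total mass.
\<close>

lemma H_word_marginal_remove_letter:
  assumes B: "B \<in> Subsets2_bar {1..n}" and F: "F \<in> H n B" and a: "a \<in> B"
  shows "word_marginal B (B - {a}) F = 0"
proof -
  have fin: "finite B" by (rule finite_index_set[OF B])
  have zero: "word_marginal B C F = 0" if "C \<in> Subsets2_bar B" "C \<noteq> B" for C
    using F that unfolding H_altdef[OF B] by auto
  show ?thesis
  proof (cases "card (B - {a}) = 1")
    case False
    then show ?thesis
      using a fin by (intro zero) (auto simp: mem_Subsets2_bar_iff)
  next
    case True
    then obtain b where b: "B - {a} = {b}" by (auto simp: card_1_singleton_iff)
    have "word_marginal B {} F = 0"
      using a fin by (intro zero) (auto simp: mem_Subsets2_bar_iff)
    then have "word_marginal B {} F [] = 0" by simp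
    then have sum0: "(\<Sum>\<sigma>\<in>words B. F \<sigma>) = 0" by (simp add: word_marginal_def)
    have "restrict_word {b} \<sigma> = [b]" if "\<sigma> \<in> words B" for \<sigma>
      using restrict_word_in_words[OF that, of "{b}"] b by auto
    then have "{\<sigma> \<in> words B. restrict_word {b} \<sigma> = \<pi>} = (if \<pi> = [b] then words B else {})" for \<pi>
      by auto
    then show ?thesis
      unfolding b word_marginal_def using sum0 by (auto simp: fun_eq_iff simp del: Collect_empty_eq)
  qed
qed

lemma synth_eq_block_extension:
  assumes B: "B \<in> Subsets2_bar {1..n}" and F: "F \<in> L (words B)" and "finite A"
  shows "synth n A F = block_extension A B F"
proof
  fix \<sigma>
  let ?c = "fact (card A - (card B - 1)) :: real"
  have coeff: "synth_dirac A \<pi> \<sigma> = (if \<sigma> \<in> words A \<and> sublist \<pi> \<sigma> then 1 / ?c else 0)"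
    if "\<pi> \<in> words B" for \<pi>
  proof -
    have len: "length \<pi> = card B" and set: "set \<pi> = B"
      using that by (auto simp: permutations_of_set_def distinct_card)
    consider "\<pi> = []" | "\<pi> \<noteq> []" "B \<subseteq> A" | "\<pi> \<noteq> []" "\<not> B \<subseteq> A" by blast
    then show ?thesis
    proof cases
      case 1
      then show ?thesis
        using len by (auto simp: synth_dirac_def scaleR_fun_def indicator_def)
    next
      case 2
      then have "card B \<ge> 1" using len by (cases \<pi>) auto
      moreover have "card B \<le> card A" using 2 assms(3) by (simp add: card_mono)
      ultimately have "card A - length \<pi> + 1 = card A - (card B - 1)" using len by simp
      then show ?thesis
        using 2 set by (auto simp: synth_dirac_def scaleR_fun_def indicator_def)
    next
      case 3
      then have "\<not> (\<sigma> \<in> words A \<and> sublist \<pi> \<sigma>)"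
        using set set_mono_sublist by (auto simp: permutations_of_set_def)
      then show ?thesis using 3 set by (auto simp: synth_dirac_def)
    qed
  qed
  have "synth n A F \<sigma> = (\<Sum>\<pi>\<in>words_bar n. F \<pi> * synth_dirac A \<pi> \<sigma>)"
    by (simp add: synth_def sum_fun_apply scaleR_fun_def)
  also have "\<dots> = (\<Sum>\<pi>\<in>words B. F \<pi> * synth_dirac A \<pi> \<sigma>)"
    using words_subset_words_bar[OF B] F finite_words_n
    by (intro sum.mono_neutral_right) (auto simp: words_bar_def L_def)
  also have "\<dots> = (\<Sum>\<pi>\<in>words B. if sublist \<pi> \<sigma> then (if \<sigma> \<in> words A then F \<pi> / ?c else 0) else 0)"
    using coeff by (intro sum.cong) auto
  also have "\<dots> = (\<Sum>\<pi> | \<pi> \<in> words B \<and> sublist \<pi> \<sigma>. if \<sigma> \<in> words A then F \<pi> / ?c else 0)"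
    by (rule sum.inter_filter[symmetric]) simp
  also have "\<dots> = block_extension A B F \<sigma>"
    by (simp add: block_extension_def sum_divide_distrib)
  finally show "synth n A F \<sigma> = block_extension A B F \<sigma>" .
qed

lemma linear_synth: "linear (synth n A)"
  by (intro linearI)
    (simp_all add: synth_def scaleR_fun_def sum.distrib scaleR_add_left scaleR_sum_right fun_eq_iff
      sum_fun_apply algebra_simps sum_distrib_left)

lemma subspace_L: "subspace (L E)"
  by (auto simp: subspace_def L_def scaleR_fun_def)

lemma subspace_H:
  assumes "B \<in> Subsets2_bar {1..n}"
  shows "subspace (H n B)"
  using subspace_L[of "words B"]
  unfolding H_altdef[OF assms] subspace_def
  by (auto simp: word_marginal_add word_marginal_scale linear_0[OF linear_word_marginal])

text \<open>
  The commutation rule.  With \<open>A' = B\<close> it recovers \<open>F\<close> from its synthesis; with \<open>A'\<close> not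
  containing \<open>B\<close> both sides vanish.
\<close>

lemma word_marginal_synth:
  assumes A: "A \<in> Subsets2_bar {1..n}" and B: "B \<in> Subsets2_bar {1..n}" and F: "F \<in> H n B"
    and A': "A' \<subseteq> A"
  shows "word_marginal A A' (synth n A F) = synth n A' F"
proof -
  have fin: "finite A" "finite A'"
    using finite_index_set[OF A] A' finite_subset by blast+
  have FL: "F \<in> L (words B)" using F H_subset_L by blast
  have "card B \<noteq> 1" using B by (simp add: mem_Subsets2_bar_iff)
  then show ?thesis
    using synth_eq_block_extension[OF B FL] fin A'
      word_marginal_block_extension[OF fin(1) A' _ H_word_marginal_remove_letter[OF B F]]
    by simp
qed

lemma synth_self:
  assumes B: "B \<in> Subsets2_bar {1..n}" and F: "F \<in> H n B"
  shows "synth n B F = F"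
  using synth_eq_block_extension[OF B] block_extension_self F H_subset_L finite_index_set[OF B]
  by (metis subsetD)

lemma synth_not_subset:
  assumes "B \<in> Subsets2_bar {1..n}" and "F \<in> H n B" and "finite A" and "\<not> B \<subseteq> A"
  shows "synth n A F = 0"
  using synth_eq_block_extension[OF assms(1) _ assms(3)] block_extension_not_subset[OF assms(4)]
    assms(2) H_subset_L by (metis subsetD)

section \<open>The multiresolution decomposition\<close>

text \<open>
  Solution of the triangular system: the part of the marginal of \<open>F\<close> on \<open>B\<close> that is not explained by
  the components at smaller index sets.  The case of infinite \<open>B\<close> only serves termination.
\<close>

function detail :: "nat \<Rightarrow> nat set \<Rightarrow> (nat list \<Rightarrow> real) \<Rightarrow> nat set \<Rightarrow> nat list \<Rightarrow> real"
  where "detail n A F B =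
    (if finite B then word_marginal A B F - (\<Sum>C\<in>Subsets2_bar B - {B}. synth n B (detail n A F C))
     else 0)"
  by pat_completeness auto
termination
proof (relation "inv_image less_than (\<lambda>(n, A, F, B). card B)")
  fix n A F B C assume "finite (B :: nat set)" "C \<in> Subsets2_bar B - {B}"
  then show "((n, A, F, C), (n, A, F, B)) \<in> inv_image less_than (\<lambda>(n, A, F, B). card B)"
    by (auto simp: mem_Subsets2_bar_iff intro!: psubset_card_mono)
qed simp

declare detail.simps [simp del]

lemma sum_synth_detail:
  assumes "B \<in> Subsets2_bar {1..n}" and "detail n A F B \<in> H n B"
  shows "(\<Sum>C\<in>Subsets2_bar B. synth n B (detail n A F C)) = word_marginal A B F"
proof -
  have fin: "finite B" by (rule finite_index_set[OF assms(1)])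
  have "(\<Sum>C\<in>Subsets2_bar B. synth n B (detail n A F C))
      = synth n B (detail n A F B) + (\<Sum>C\<in>Subsets2_bar B - {B}. synth n B (detail n A F C))"
    using Subsets2_bar_self[OF assms(1)] finite_Subsets2_bar[OF fin] by (simp add: sum.remove)
  also have "\<dots> = word_marginal A B F"
    using synth_self[OF assms] fin by (simp add: detail.simps[of n A F B])
  finally show ?thesis .
qed

text \<open>
  Marginalised to a proper subset \<open>B'\<close>, the subtracted sum loses the terms whose index is not
  contained in \<open>B'\<close>, and the rest adds up to the marginal of \<open>F\<close> on \<open>B'\<close>.
\<close>

lemma detail_in_H:
  assumes A: "A \<in> Subsets2_bar {1..n}" and "B \<in> Subsets2_bar A"
  shows "detail n A F B \<in> H n B"
proof -
  have "finite B"
    using Subsets2_bar_trans[OF assms] finite_index_set by blast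
  then show ?thesis using assms(2)
  proof (induction B rule: finite_psubset_induct)
    case (psubset B)
    have B: "B \<in> Subsets2_bar {1..n}"
      by (rule Subsets2_bar_trans[OF A psubset.prems])
    have finA: "finite A" by (rule finite_index_set[OF A])
    have BA: "B \<subseteq> A" using psubset.prems finA by (simp add: mem_Subsets2_bar_iff)
    have below: "C \<in> Subsets2_bar A \<and> C \<in> Subsets2_bar {1..n} \<and> detail n A F C \<in> H n C"
      if "C \<in> Subsets2_bar B" "C \<noteq> B" for C
    proof -
      have "C \<subset> B" "C \<in> Subsets2_bar A"
        using that BA psubset.hyps finA by (auto simp: mem_Subsets2_bar_iff)
      then show ?thesis
        using psubset.IH Subsets2_bar_trans[OF A] by blast
    qed
    let ?S = "\<Sum>C\<in>Subsets2_bar B - {B}. synth n B (detail n A F C)"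
    have eq: "detail n A F B = word_marginal A B F - ?S"
      using psubset.hyps by (simp add: detail.simps[of n A F B])
    have synthL: "synth n B (detail n A F C) \<in> L (words B)" if "C \<in> Subsets2_bar B - {B}" for C
    proof -
      have C: "C \<in> Subsets2_bar {1..n}" "detail n A F C \<in> L (words C)"
        using below[of C] that H_subset_L by auto
      show ?thesis
        unfolding synth_eq_block_extension[OF C psubset.hyps] by (rule block_extension_in_L)
    qed
    have "detail n A F B \<in> L (words B)"
      unfolding eq using synthL
      by (intro subspace_diff[OF subspace_L] word_marginal_in_L[OF BA] subspace_sum[OF subspace_L])
    moreover have "word_marginal B B' (detail n A F B) = 0" if B': "B' \<in> Subsets2_bar B" "B' \<noteq> B" for B'
    proof -
      have B'B: "B' \<subset> B" using B' psubset.hyps by (auto simp: mem_Subsets2_bar_iff)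
      have finB': "finite B'" using B'B psubset.hyps finite_subset by blast
      have "word_marginal B B' ?S
          = (\<Sum>C\<in>Subsets2_bar B - {B}. word_marginal B B' (synth n B (detail n A F C)))"
        by (rule linear_sum[OF linear_word_marginal])
      also have "\<dots> = (\<Sum>C\<in>Subsets2_bar B - {B}. synth n B' (detail n A F C))"
        using below B'B by (intro sum.cong refl word_marginal_synth[OF B]) auto
      also have "\<dots> = (\<Sum>C\<in>Subsets2_bar B'. synth n B' (detail n A F C))"
      proof (rule sum.mono_neutral_right)
        show "finite (Subsets2_bar B - {B})"
          using finite_Subsets2_bar psubset.hyps by blast
        show "Subsets2_bar B' \<subseteq> Subsets2_bar B - {B}"
        proof
          fix C assume "C \<in> Subsets2_bar B'"
          then have "C \<subseteq> B'" "card C \<noteq> 1" by (simp_all add: mem_Subsets2_bar_iff[OF finB'])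
          then show "C \<in> Subsets2_bar B - {B}"
            using B'B by (auto simp: mem_Subsets2_bar_iff[OF psubset.hyps])
        qed
        show "\<forall>C\<in>Subsets2_bar B - {B} - Subsets2_bar B'. synth n B' (detail n A F C) = 0"
        proof
          fix C assume C: "C \<in> Subsets2_bar B - {B} - Subsets2_bar B'"
          then have "\<not> C \<subseteq> B'"
            using psubset.hyps finB' by (auto simp: mem_Subsets2_bar_iff)
          then show "synth n B' (detail n A F C) = 0"
            using C below finB' by (intro synth_not_subset[of C]) auto
        qed
      qed
      also have "\<dots> = word_marginal A B' F"
        using below[OF B'] by (intro sum_synth_detail) auto
      also have "\<dots> = word_marginal B B' (word_marginal A B F)"
        using B'B BA by (simp add: word_marginal_trans)
      finally show ?thesis
        unfolding eq by (simp add: linear_diff[OF linear_word_marginal])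
    qed
    ultimately show ?case
      unfolding H_altdef[OF B] by blast
  qed
qed

text \<open>
  After marginalising to \<open>B\<close>, the terms with an index not contained in \<open>B\<close> vanish and those with
  a smaller index are zero by induction, so that only \<open>D B\<close> is left.
\<close>

lemma sum_synth_eq_0:
  assumes A: "A \<in> Subsets2_bar {1..n}" and D: "\<And>B. B \<in> Subsets2_bar A \<Longrightarrow> D B \<in> H n B"
    and sum0: "(\<Sum>B\<in>Subsets2_bar A. synth n A (D B)) = 0" and B: "B \<in> Subsets2_bar A"
  shows "D B = 0"
proof -
  have finA: "finite A" by (rule finite_index_set[OF A])
  have "finite B" using B finA by (auto simp: mem_Subsets2_bar_iff intro: finite_subset)
  then show ?thesis using B
  proof (induction B rule: finite_psubset_induct)
    case (psubset B)
    have B: "B \<in> Subsets2_bar {1..n}" by (rule Subsets2_bar_trans[OF A psubset.prems])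
    have BA: "B \<subseteq> A" using psubset.prems finA by (simp add: mem_Subsets2_bar_iff)
    have "0 = word_marginal A B (\<Sum>C\<in>Subsets2_bar A. synth n A (D C))"
      by (simp add: sum0 linear_0[OF linear_word_marginal])
    also have "\<dots> = (\<Sum>C\<in>Subsets2_bar A. word_marginal A B (synth n A (D C)))"
      by (rule linear_sum[OF linear_word_marginal])
    also have "\<dots> = (\<Sum>C\<in>Subsets2_bar A. synth n B (D C))"
      using D BA Subsets2_bar_trans[OF A] by (intro sum.cong refl word_marginal_synth[OF A]) auto
    also have "\<dots> = (\<Sum>C\<in>{B}. synth n B (D C))"
    proof (rule sum.mono_neutral_right)
      show "finite (Subsets2_bar A)" by (rule finite_Subsets2_bar[OF finA])
      show "{B} \<subseteq> Subsets2_bar A" using psubset.prems by simp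
      show "\<forall>C\<in>Subsets2_bar A - {B}. synth n B (D C) = 0"
      proof
        fix C assume C: "C \<in> Subsets2_bar A - {B}"
        show "synth n B (D C) = 0"
        proof (cases "C \<subseteq> B")
          case True
          then have "D C = 0" using psubset.IH C by blast
          then show ?thesis by (simp add: linear_0[OF linear_synth])
        next
          case False
          then show ?thesis
            using C D Subsets2_bar_trans[OF A] psubset.hyps by (intro synth_not_subset[of C]) auto
        qed
      qed
    qed
    also have "\<dots> = D B" using synth_self[OF B D[OF psubset.prems]] by simp
    finally show ?case by simp
  qed
qed

lemma inj_on_synth:
  assumes A: "A \<in> Subsets2_bar {1..n}" and B: "B \<in> Subsets2_bar A"
  shows "inj_on (synth n A) (H n B)"
proof (rule inj_on_inverseI)
  fix F assume F: "F \<in> H n B"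
  have B': "B \<in> Subsets2_bar {1..n}" by (rule Subsets2_bar_trans[OF A B])
  have "B \<subseteq> A" using B finite_index_set[OF A] by (simp add: mem_Subsets2_bar_iff)
  then show "word_marginal A B (synth n A F) = F"
    using word_marginal_synth[OF A B' F] synth_self[OF B' F] by simp
qed

lemma synth_in_L:
  assumes A: "A \<in> Subsets2_bar {1..n}" and B: "B \<in> Subsets2_bar A" and F: "F \<in> H n B"
  shows "synth n A F \<in> L (words A)"
  using synth_eq_block_extension[OF Subsets2_bar_trans[OF A B] _ finite_index_set[OF A]]
    F H_subset_L block_extension_in_L by (metis subsetD)

lemma is_direct_sum_synth_H:
  assumes A: "A \<in> Subsets2_bar {1..n}"
  shows "is_direct_sum (L (words A)) (Subsets2_bar A) (\<lambda>B. synth n A ` H n B)"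
  unfolding is_direct_sum_def
proof (intro conjI ballI)
  have finA: "finite A" by (rule finite_index_set[OF A])
  show "subspace (L (words A))" by (rule subspace_L)
  show "finite (Subsets2_bar A)" by (rule finite_Subsets2_bar[OF finA])
  show "subspace (synth n A ` H n B)" if "B \<in> Subsets2_bar A" for B
    using linear_subspace_image[OF linear_synth] subspace_H Subsets2_bar_trans[OF A that] by blast
  show "synth n A ` H n B \<subseteq> L (words A)" if "B \<in> Subsets2_bar A" for B
    using synth_in_L[OF A that] by blast
  fix F assume F: "F \<in> L (words A)"
  let ?w = "\<lambda>B\<in>Subsets2_bar A. synth n A (detail n A F B)"
  show "\<exists>!w. w \<in> (\<Pi>\<^sub>E B\<in>Subsets2_bar A. synth n A ` H n B) \<and> F = (\<Sum>B\<in>Subsets2_bar A. w B)"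
  proof (rule ex_ex1I)
    have "(\<Sum>B\<in>Subsets2_bar A. ?w B) = F"
      using sum_synth_detail[OF A detail_in_H[OF A Subsets2_bar_self[OF A]]] word_marginal_self[OF F]
      by simp
    moreover have "?w \<in> (\<Pi>\<^sub>E B\<in>Subsets2_bar A. synth n A ` H n B)"
      using detail_in_H[OF A] by auto
    ultimately show "\<exists>w. w \<in> (\<Pi>\<^sub>E B\<in>Subsets2_bar A. synth n A ` H n B) \<and> F = (\<Sum>B\<in>Subsets2_bar A. w B)"
      by metis
  next
    fix w w' 
    assume w: "w \<in> (\<Pi>\<^sub>E B\<in>Subsets2_bar A. synth n A ` H n B) \<and> F = (\<Sum>B\<in>Subsets2_bar A. w B)"
      and w': "w' \<in> (\<Pi>\<^sub>E B\<in>Subsets2_bar A. synth n A ` H n B) \<and> F = (\<Sum>B\<in>Subsets2_bar A. w' B)"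
    have "\<exists>G. G \<in> H n B \<and> w B = synth n A G" "\<exists>G. G \<in> H n B \<and> w' B = synth n A G"
      if "B \<in> Subsets2_bar A" for B
      using w w' that by blast+
    then obtain G G' where G: "\<And>B. B \<in> Subsets2_bar A \<Longrightarrow> G B \<in> H n B \<and> w B = synth n A (G B)"
      and G': "\<And>B. B \<in> Subsets2_bar A \<Longrightarrow> G' B \<in> H n B \<and> w' B = synth n A (G' B)"
      by metis
    have eq: "G B - G' B = 0" if "B \<in> Subsets2_bar A" for B
    proof (rule sum_synth_eq_0[OF A _ _ that])
      show "G C - G' C \<in> H n C" if "C \<in> Subsets2_bar A" for C
        using subspace_diff[OF subspace_H[OF Subsets2_bar_trans[OF A that]]] G G' that by blast
      have "(\<Sum>C\<in>Subsets2_bar A. synth n A (G C - G' C)) = (\<Sum>C\<in>Subsets2_bar A. w C - w' C)"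
        using G G' by (intro sum.cong) (auto simp: linear_diff[OF linear_synth])
      also have "\<dots> = 0" using w w' by (metis sum_subtractf right_minus_eq)
      finally show "(\<Sum>C\<in>Subsets2_bar A. synth n A (G C - G' C)) = 0" .
    qed
    show "w = w'"
    proof (rule PiE_ext)
      show "w \<in> (\<Pi>\<^sub>E B\<in>Subsets2_bar A. synth n A ` H n B)" "w' \<in> (\<Pi>\<^sub>E B\<in>Subsets2_bar A. synth n A ` H n B)"
        using w w' by blast+
      show "w B = w' B" if "B \<in> Subsets2_bar A" for B
        using eq[OF that] G[OF that] G'[OF that] by simp
    qed
  qed
qed

section \<open>Dimensions of the detail spaces\<close>

lemma fact_eq_sum_dim_H:
  assumes A: "A \<in> Subsets2_bar {1..n}"
  shows "fact (card A) = (\<Sum>B\<in>Subsets2_bar A. dim (H n B))"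
proof -
  have finA: "finite A" by (rule finite_index_set[OF A])
  have "fact (card A) = dim (L (words A))"
    using finA by (simp add: dim_L)
  also have "\<dots> = (\<Sum>B\<in>Subsets2_bar A. dim (synth n A ` H n B))"
    by (rule dim_direct_sum[OF is_direct_sum_synth_H[OF A], of "dirac ` words A"])
      (simp_all add: L_eq_span_diracs)
  also have "\<dots> = (\<Sum>B\<in>Subsets2_bar A. dim (H n B))"
    using inj_on_synth[OF A] subspace_H Subsets2_bar_trans[OF A]
    by (intro sum.cong refl dim_linear_image linear_synth) auto
  finally show ?thesis .
qed

text \<open>
  \<open>fact_eq_sum_dim_H\<close> and \<open>fact_eq_sum_derangements\<close> are the same recursion, and each determines the
  value at \<open>B\<close> from the values at its proper subsets.
\<close>

lemma dim_H:
  assumes "B \<in> Subsets2_bar {1..n}"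
  shows "dim (H n B) = derangement_number (card B)"
proof -
  have "finite B" by (rule finite_index_set[OF assms])
  then show ?thesis using assms
  proof (induction B rule: finite_psubset_induct)
    case (psubset B)
    have split: "sum f (Subsets2_bar B) = f B + sum f (Subsets2_bar B - {B})" for f :: "nat set \<Rightarrow> nat"
      using Subsets2_bar_self[OF psubset.prems] finite_Subsets2_bar[OF psubset.hyps]
      by (simp add: sum.remove)
    have "dim (H n C) = derangement_number (card C)" if "C \<in> Subsets2_bar B - {B}" for C
      using that psubset Subsets2_bar_trans[OF psubset.prems]
      by (auto simp: mem_Subsets2_bar_iff[OF psubset.hyps])
    then have "(\<Sum>C\<in>Subsets2_bar B - {B}. dim (H n C))
        = (\<Sum>C\<in>Subsets2_bar B - {B}. derangement_number (card C))"
      by (rule sum.cong[OF refl])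
    then show ?case
      using fact_eq_sum_dim_H[OF psubset.prems] fact_eq_sum_derangements[OF psubset.hyps]
      by (simp add: split)
  qed
qed

theorem theorem26:
  fixes n :: nat and A :: "nat set"
  assumes "n \<ge> 1"
    and "A \<in> Subsets2_bar {1..n}"
  shows "is_direct_sum (L (words A)) (Subsets2_bar A) (\<lambda>B. synth n A ` H n B) \<and>
    (\<forall>B\<in>Subsets2_bar A.
       (inj_on (synth n A) (H n B) \<and> {F \<in> H n B. synth n A F = 0} = {0}) \<and>
       (\<forall>F\<in>H n B. \<forall>A'\<in>Subsets2_bar A. marginal n A' (synth n A F) = synth n A' F) \<and>
       dim (H n B) = derangement_number (card B))"
proof (intro conjI ballI)
  note A = assms(2)
  show "is_direct_sum (L (words A)) (Subsets2_bar A) (\<lambda>B. synth n A ` H n B)"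
    by (rule is_direct_sum_synth_H[OF A])
  fix B assume B: "B \<in> Subsets2_bar A"
  have B': "B \<in> Subsets2_bar {1..n}" by (rule Subsets2_bar_trans[OF A B])
  show inj: "inj_on (synth n A) (H n B)" by (rule inj_on_synth[OF A B])
  have "0 \<in> H n B" "synth n A 0 = 0"
    by (simp_all add: subspace_0 subspace_H[OF B'] linear_0[OF linear_synth])
  then show "{F \<in> H n B. synth n A F = 0} = {0}"
    using inj unfolding inj_on_def by force
  show "dim (H n B) = derangement_number (card B)" by (rule dim_H[OF B'])
  fix F A' assume F: "F \<in> H n B" and A': "A' \<in> Subsets2_bar A"
  have "A' \<subseteq> A" using A' finite_index_set[OF A] by (simp add: mem_Subsets2_bar_iff)
  then show "marginal n A' (synth n A F) = synth n A' F"
    using marginal_eq_word_marginal[OF A synth_in_L[OF A B F] A'] word_marginal_synth[OF A B' F]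
    by simp
qed

end
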